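(* Let $G=(V,E,A)$ be a mixed graph. Then $(-1)^{|V|}\chi_G(-1)$ equals the number of acyclic orientations of $G$.
   Context: A mixed graph $G=(V,E,A)$ has a finite vertex set $V$, a set $E$ of undirected edges $\{v,w\}$ and a set $A$ of directed edges $(v,w)$; it is assumed to be simple, i.e. it contains neither multiple edges nor loops. Write $[t]=\{1,2,\dots,t\}$. A proper $t$-coloring of $G$ is a map $c:V\to[t]$ with $c(v)\ne c(w)$ for all $\{v,w\}\in E$ and $c(v)<c(w)$ for all $(v,w)\in A$. $\chi_G(t)$ denotes the number of proper $t$-colorings of $G$; this function agrees with a polynomial in $t$, and $\chi_G(-1)$ denotes the evaluation of that polynomial at $-1$. An orientation of $G$ is obtained by keeping each directed edge and orienting each undirected edge; it is acyclic if it contains no coherently-oriented cycle. *)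

theory Defs
  imports Complex_Main "HOL-Library.FuncSet" "HOL-Computational_Algebra.Polynomial"
begin

text \<open>
  An undirected edge is a two-element set of vertices, an arc from v to w is the pair (v, w).
  Since E and A are sets, the only parallel edges left to exclude are an undirected edge and
  an arc between the same two vertices. Opposite arcs (v, w) and (w, v) are not parallel
  and are allowed; the stricter convention that forbids them is a special case.
\<close>

locale mixed_graph =
  fixes V :: "'a set" and E :: "'a set set" and A :: "('a \<times> 'a) set"
  assumes finite_vertices: "finite V"
    and edges: "e \<in> E \<Longrightarrow> e \<subseteq> V \<and> card e = 2"
    and arcs: "(v, w) \<in> A \<Longrightarrow> v \<in> V \<and> w \<in> V \<and> v \<noteq> w"
    and no_parallel: "(v, w) \<in> A \<Longrightarrow> {v, w} \<notin> E"

text \<open>Colorings are extensional functions on V, so that they can be counted.\<close>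

definition proper_colorings ::
    "'a set \<Rightarrow> 'a set set \<Rightarrow> ('a \<times> 'a) set \<Rightarrow> nat \<Rightarrow> ('a \<Rightarrow> nat) set" where
  "proper_colorings V E A t =
     {c \<in> V \<rightarrow>\<^sub>E {1..t}.
        (\<forall>v w. {v, w} \<in> E \<longrightarrow> c v \<noteq> c w) \<and> (\<forall>v w. (v, w) \<in> A \<longrightarrow> c v < c w)}"

text \<open>
  The coefficients need not be integers: a single arc gives \<open>t (t - 1) / 2\<close>.
  There is at most one such polynomial, as its values at all natural numbers are prescribed.
\<close>

definition chromatic_poly :: "'a set \<Rightarrow> 'a set set \<Rightarrow> ('a \<times> 'a) set \<Rightarrow> real poly" where
  "chromatic_poly V E A =
     (THE p. \<forall>t. poly p (real t) = real (card (proper_colorings V E A t)))"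

text \<open>
  The function h chooses a direction for every undirected edge. As no arc is parallel to an
  undirected edge, the resulting arc set D determines h on E, so counting the sets D
  is counting orientations.
\<close>

definition orientations :: "'a set set \<Rightarrow> ('a \<times> 'a) set \<Rightarrow> ('a \<times> 'a) set set" where
  "orientations E A =
     {D. \<exists>h. (\<forall>e\<in>E. {fst (h e), snd (h e)} = e) \<and> D = A \<union> h ` E}"

definition acyclic_orientations :: "'a set set \<Rightarrow> ('a \<times> 'a) set \<Rightarrow> ('a \<times> 'a) set set" where
  "acyclic_orientations E A = {D \<in> orientations E A. acyclic D}"

end

theory Submission
  imports Defs
begin

text \<open>
  A proper coloring \<open>c\<close> orients every undirected edge towards its larger color, and the
  resulting orientation \<open>D\<close> is the only one along whose arcs \<open>c\<close> increases. The colorings of the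
  mixed graph are thus the disjoint union, over all orientations \<open>D\<close>, of the vertex labelings
  that increase along \<open>D\<close> (\<open>proper_colorings_eq_UN\<close>). An orientation with a cycle has no such
  labeling, so \<open>\<chi>\<^sub>G\<close> is the sum of the strict order polynomials of the acyclic orientations, and
  it is enough to see that each of these takes the value \<open>(-1)\<^sup>n\<close> at \<open>-1\<close>, where \<open>n\<close> is the
  number of vertices.

  This is the content of \<open>strict_order_polynomial\<close>. Let \<open>M \<noteq> {}\<close> be the set of sinks of an acyclic
  digraph on \<open>W \<noteq> {}\<close>, and let \<open>p\<^sub>W\<close> count its strict labelings. The vertices with the top label
  \<open>t + 1\<close> can form any subset \<open>S\<close> of \<open>M\<close>, and the other vertices are labeled strictly by
  \<open>1, \<dots>, t\<close>. Hence \<open>p\<^sub>W (t + 1) = (\<Sum>S\<subseteq>M. p\<^sub>W\<^sub>-\<^sub>S (t))\<close>. The terms with \<open>S \<noteq> {}\<close> are polynomials by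
  induction, their sum is the forward difference of \<open>p\<^sub>W\<close>, and so \<open>p\<^sub>W\<close> is a polynomial, with
  \<open>p\<^sub>W (0) = 0\<close>. At \<open>t = -1\<close> the difference equation reads
  \<open>- p\<^sub>W (-1) = (\<Sum>{} \<noteq> S \<subseteq> M. (-1)\<^bsup>n - |S|\<^esup>) = - (-1)\<^sup>n\<close>, because the alternating sum over all
  subsets of \<open>M\<close> vanishes.
\<close>

section \<open>Polynomials and finite differences\<close>

lemma poly_eq_if_eq_on_nat:
  fixes p q :: "'a::{idom, ring_char_0} poly"
  assumes "\<And>n::nat. poly p (of_nat n) = poly q (of_nat n)"
  shows "p = q"
proof (rule ccontr)
  assume "p \<noteq> q"
  then have "finite {x. poly (p - q) x = 0}"
    by (intro poly_roots_finite) simp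
  moreover have "range of_nat \<subseteq> {x. poly (p - q) x = 0}"
    using assms by auto
  ultimately have "finite (range (of_nat :: nat \<Rightarrow> 'a))"
    by (rule rev_finite_subset)
  then show False
    by (simp add: finite_image_iff inj_of_nat)
qed

text \<open>
  The forward difference of \<open>x\<^bsup>m+1\<^esup>\<close> is \<open>(m + 1) x\<^sup>m\<close> plus multiples of lower powers, whose
  antidifferences are available by induction and can be subtracted.
\<close>

lemma monom_antidifference:
  "\<exists>p :: 'a::field_char_0 poly. poly p 0 = 0 \<and> (\<forall>x. poly p (x + 1) - poly p x = x ^ m)"
proof (induction m rule: less_induct)
  case (less m)
  then obtain P :: "nat \<Rightarrow> 'a poly" where P0: "\<And>i. i < m \<Longrightarrow> poly (P i) 0 = 0"
    and P: "\<And>i x. i < m \<Longrightarrow> poly (P i) (x + 1) - poly (P i) x = x ^ i"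
    by metis
  define p where
    "p = smult (1 / of_nat (Suc m))
           (monom 1 (Suc m) - (\<Sum>i<m. smult (of_nat (Suc m choose i)) (P i)))"
  have "poly p 0 = 0"
    by (simp add: p_def poly_monom poly_sum P0)
  moreover have "poly p (x + 1) - poly p x = x ^ m" for x
  proof -
    have "(x + 1) ^ Suc m = (\<Sum>i\<le>Suc m. of_nat (Suc m choose i) * x ^ i)"
      using binomial_ring[of x 1 "Suc m"] by simp
    also have "\<dots> = (\<Sum>i<m. of_nat (Suc m choose i) * x ^ i) + of_nat (Suc m) * x ^ m + x ^ Suc m"
      by (simp only: lessThan_Suc_atMost[symmetric] sum.lessThan_Suc binomial_Suc_n binomial_n_n) simp
    finally have bin: "(x + 1) ^ Suc m - x ^ Suc m - (\<Sum>i<m. of_nat (Suc m choose i) * x ^ i)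
        = of_nat (Suc m) * x ^ m"
      by simp
    have "(\<Sum>i<m. of_nat (Suc m choose i) * x ^ i)
        = (\<Sum>i<m. of_nat (Suc m choose i) * poly (P i) (x + 1))
          - (\<Sum>i<m. of_nat (Suc m choose i) * poly (P i) x)"
      by (simp add: P[symmetric] sum_subtractf right_diff_distrib)
    then have "of_nat (Suc m) * (poly p (x + 1) - poly p x) = of_nat (Suc m) * x ^ m"
      unfolding p_def poly_smult right_diff_distrib mult.assoc[symmetric] bin[symmetric]
      by (simp add: poly_monom poly_sum del: of_nat_Suc)
    then show ?thesis
      by (simp del: of_nat_Suc)
  qed
  ultimately show ?case
    by blast
qed

lemma poly_antidifference:
  fixes q :: "'a::field_char_0 poly"
  obtains p where "poly p 0 = 0" "\<And>x. poly p (x + 1) - poly p x = poly q x"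
proof -
  obtain P :: "nat \<Rightarrow> 'a poly" where P0: "\<And>i. poly (P i) 0 = 0"
    and P: "\<And>i x. poly (P i) (x + 1) - poly (P i) x = x ^ i"
    using monom_antidifference by metis
  let ?p = "\<Sum>i\<le>degree q. smult (coeff q i) (P i)"
  have "poly ?p 0 = 0"
    by (simp add: poly_sum P0)
  moreover have "poly ?p (x + 1) - poly ?p x = poly q x" for x
  proof -
    have "poly ?p (x + 1) - poly ?p x
        = (\<Sum>i\<le>degree q. coeff q i * (poly (P i) (x + 1) - poly (P i) x))"
      by (simp add: poly_sum sum_subtractf right_diff_distrib)
    then show ?thesis
      by (simp add: P poly_altdef[of q])
  qed
  ultimately show ?thesis
    by (rule that)
qed

section \<open>Strict labelings of a digraph\<close>

definition strict_labelings :: "('a \<times> 'a) set \<Rightarrow> 'a set \<Rightarrow> nat \<Rightarrow> ('a \<Rightarrow> nat) set" where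
  "strict_labelings D W t =
     {c \<in> W \<rightarrow>\<^sub>E {1..t}. \<forall>v\<in>W. \<forall>w\<in>W. (v, w) \<in> D \<longrightarrow> c v < c w}"

definition sinks :: "('a \<times> 'a) set \<Rightarrow> 'a set \<Rightarrow> 'a set" where
  "sinks D W = {v \<in> W. \<forall>w\<in>W. (v, w) \<notin> D}"

lemma finite_strict_labelings: "finite W \<Longrightarrow> finite (strict_labelings D W t)"
  unfolding strict_labelings_def
  by (rule finite_subset[OF _ finite_PiE[of W "\<lambda>_. {1..t}"]]) auto

lemma sinks_nonempty:
  assumes "finite W" "W \<noteq> {}" "acyclic D"
  shows "sinks D W \<noteq> {}"
proof -
  have "acyclic (Restr D W)"
    using assms(3) by (rule acyclic_subset) auto
  moreover have "finite (Restr D W)"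
    using assms(1) by auto
  ultimately have "wf ((Restr D W)\<inverse>)"
    by (rule finite_acyclic_wf_converse[rotated])
  then obtain v where v: "v \<in> W" "\<And>w. (w, v) \<in> (Restr D W)\<inverse> \<Longrightarrow> w \<notin> W"
    using assms(2) by (metis wfE_min ex_in_conv)
  have "(v, w) \<notin> D" if "w \<in> W" for w
    using v(1) v(2)[of w] that by auto
  then have "v \<in> sinks D W"
    using v(1) by (simp add: sinks_def)
  then show ?thesis
    by blast
qed

text \<open>
  A vertex with the largest label has no out-neighbor in \<open>W\<close>, so these vertices form a set \<open>S\<close> of
  sinks. Conversely, giving a new top label to any set of sinks violates no constraint, and
  removing \<open>S\<close> leaves a strict labeling of \<open>W - S\<close> with one label fewer.
\<close>

lemma card_strict_labelings_Suc:
  assumes "finite W"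
  shows "card (strict_labelings D W (Suc t)) =
           (\<Sum>S\<in>Pow (sinks D W). card (strict_labelings D (W - S) t))"
proof -
  let ?top = "\<lambda>c. {v \<in> W. c v = Suc t}"
  let ?f = "\<lambda>c. (?top c, restrict c (W - ?top c))"
  let ?g = "\<lambda>(S, c) v. if v \<in> S then Suc t else c v"
  have sub: "sinks D W \<subseteq> W"
    by (auto simp: sinks_def)
  have "bij_betw ?f (strict_labelings D W (Suc t))
          (Sigma (Pow (sinks D W)) (\<lambda>S. strict_labelings D (W - S) t))"
  proof (rule bij_betw_byWitness[where f' = ?g])
    show "\<forall>c\<in>strict_labelings D W (Suc t). ?g (?f c) = c"
      by (auto simp: strict_labelings_def fun_eq_iff PiE_def extensional_def)
    show "\<forall>x\<in>Sigma (Pow (sinks D W)) (\<lambda>S. strict_labelings D (W - S) t). ?f (?g x) = x"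
    proof
      fix x assume "x \<in> Sigma (Pow (sinks D W)) (\<lambda>S. strict_labelings D (W - S) t)"
      then obtain S c where x: "x = (S, c)"
        and S: "S \<subseteq> sinks D W" and c: "c \<in> strict_labelings D (W - S) t"
        by auto
      have "c v \<le> t" if "v \<in> W" "v \<notin> S" for v
        using c that by (auto simp: strict_labelings_def)
      then have top: "?top (?g (S, c)) = S"
        using S sub by (fastforce split: if_splits)
      have "c v = undefined" if "v \<notin> W - S" for v
        using c that by (auto simp: strict_labelings_def PiE_def extensional_def)
      then have "restrict (?g (S, c)) (W - S) = c"
        by (auto simp: fun_eq_iff)
      then show "?f (?g x) = x"
        unfolding x top by simp
    qed
    show "?f ` strict_labelings D W (Suc t) \<subseteq>
            Sigma (Pow (sinks D W)) (\<lambda>S. strict_labelings D (W - S) t)"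
    proof (rule image_subsetI)
      fix c assume c: "c \<in> strict_labelings D W (Suc t)"
      then have bnd: "1 \<le> c v" "c v \<le> Suc t" if "v \<in> W" for v
        using that by (auto simp: strict_labelings_def PiE_def Pi_def)
      have mono: "c v < c w" if "v \<in> W" "w \<in> W" "(v, w) \<in> D" for v w
        using c that by (auto simp: strict_labelings_def)
      have "?top c \<subseteq> sinks D W"
        using mono bnd by (fastforce simp: sinks_def)
      moreover have "restrict c (W - ?top c) \<in> strict_labelings D (W - ?top c) t"
        using mono bnd by (fastforce simp: strict_labelings_def le_Suc_eq)
      ultimately show "?f c \<in> Sigma (Pow (sinks D W)) (\<lambda>S. strict_labelings D (W - S) t)"
        by blast
    qed
    show "?g ` Sigma (Pow (sinks D W)) (\<lambda>S. strict_labelings D (W - S) t)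
            \<subseteq> strict_labelings D W (Suc t)"
    proof (rule image_subsetI)
      fix x assume "x \<in> Sigma (Pow (sinks D W)) (\<lambda>S. strict_labelings D (W - S) t)"
      then obtain S c where x: "x = (S, c)"
        and S: "S \<subseteq> sinks D W" and c: "c \<in> strict_labelings D (W - S) t"
        by auto
      have bnd: "1 \<le> c v" "c v \<le> t" if "v \<in> W" "v \<notin> S" for v
        using c that by (auto simp: strict_labelings_def PiE_def Pi_def)
      have mono: "c v < c w" if "v \<in> W - S" "w \<in> W - S" "(v, w) \<in> D" for v w
        using c that by (auto simp: strict_labelings_def)
      have ext: "c v = undefined" if "v \<notin> W" for v
        using c that by (auto simp: strict_labelings_def PiE_def extensional_def)
      have "(v, w) \<notin> D" if "v \<in> S" "w \<in> W" for v w
        using S that by (auto simp: sinks_def)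
      then show "?g x \<in> strict_labelings D W (Suc t)"
        using S sub bnd mono ext unfolding x
        by (auto simp: strict_labelings_def le_Suc_eq less_Suc_eq_le PiE_def Pi_def extensional_def)
    qed
  qed
  then have "card (strict_labelings D W (Suc t)) =
      card (Sigma (Pow (sinks D W)) (\<lambda>S. strict_labelings D (W - S) t))"
    by (rule bij_betw_same_card)
  also have "\<dots> = (\<Sum>S\<in>Pow (sinks D W). card (strict_labelings D (W - S) t))"
    using assms finite_subset[OF sub assms]
    by (intro card_SigmaI) (auto intro: finite_strict_labelings)
  finally show ?thesis .
qed

text \<open>This is the expansion of the product \<open>\<Prod>x\<in>M. (-1 + 1)\<close> over subsets.\<close>

lemma sum_Pow_minus_one_power:
  assumes "finite M" "M \<noteq> {}"
  shows "(\<Sum>S\<in>Pow M. (-1) ^ card S) = (0 :: 'a::comm_ring_1)"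
proof -
  have "(\<Sum>S\<in>Pow M. (-1) ^ card S) = (\<Prod>x\<in>M. (-1) + (1 :: 'a))"
    unfolding prod_add[OF assms(1)] by simp
  also have "\<dots> = 0"
    using assms by (simp add: power_0_left)
  finally show ?thesis .
qed

text \<open>
  The polynomial and its value at \<open>-1\<close> are obtained in one induction: the difference equation
  for the sum over nonempty sets of sinks determines both. The empty set of sinks accounts
  for the term \<open>poly p x\<close> in the forward difference.
\<close>

lemma strict_order_polynomial:
  assumes "finite W" "acyclic D"
  shows "\<exists>p :: real poly. (\<forall>t. poly p (real t) = real (card (strict_labelings D W t))) \<and>
                          poly p (-1) = (-1) ^ card W"
  using assms(1)
proof (induction W rule: finite_psubset_induct)
  case (psubset W)
  let ?M = "sinks D W"
  show ?case
  proof (cases "W = {}")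
    case True
    then have "strict_labelings D W t = {\<lambda>_. undefined}" for t
      by (auto simp: strict_labelings_def)
    then show ?thesis
      using True by (intro exI[of _ 1]) simp
  next
    case False
    have M: "?M \<noteq> {}" "?M \<subseteq> W" "finite ?M"
      using sinks_nonempty[OF psubset.hyps False assms(2)] psubset.hyps by (auto simp: sinks_def)
    have "W - S \<subset> W" if "S \<in> Pow ?M - {{}}" for S
      using that M by auto
    then have "\<forall>S\<in>Pow ?M - {{}}. \<exists>p :: real poly.
        (\<forall>t. poly p (real t) = real (card (strict_labelings D (W - S) t))) \<and>
        poly p (-1) = (-1) ^ card (W - S)"
      by (intro ballI psubset.IH)
    then obtain Q :: "'a set \<Rightarrow> real poly" where
      Q: "\<And>S t. S \<in> Pow ?M - {{}} \<Longrightarrow>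
            poly (Q S) (real t) = real (card (strict_labelings D (W - S) t))"
      and Q1: "\<And>S. S \<in> Pow ?M - {{}} \<Longrightarrow> poly (Q S) (-1) = (-1) ^ card (W - S)"
      by metis
    obtain p where p0: "poly p 0 = 0"
      and p: "\<And>x. poly p (x + 1) - poly p x = poly (\<Sum>S\<in>Pow ?M - {{}}. Q S) x"
      using poly_antidifference by blast
    have "poly p (real t) = real (card (strict_labelings D W t))" for t
    proof (induction t)
      case 0
      \<comment> \<open>Without labels, only the empty vertex set can be labeled.\<close>
      have "strict_labelings D W 0 = {}"
        using False by (auto simp: strict_labelings_def PiE_def Pi_def)
      then show ?case
        using p0 by simp
    next
      case (Suc t)
      have "poly p (real (Suc t)) = poly p (real t) + (\<Sum>S\<in>Pow ?M - {{}}. poly (Q S) (real t))"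
        using p[of "real t"] by (simp add: poly_sum add.commute)
      also have "\<dots> = real (card (strict_labelings D (W - {}) t))
          + (\<Sum>S\<in>Pow ?M - {{}}. real (card (strict_labelings D (W - S) t)))"
        using Suc by (simp add: Q)
      also have "\<dots> = (\<Sum>S\<in>Pow ?M. real (card (strict_labelings D (W - S) t)))"
        using M by (subst sum.remove[of "Pow ?M" "{}"]) auto
      also have "\<dots> = real (card (strict_labelings D W (Suc t)))"
        using card_strict_labelings_Suc[OF psubset.hyps] by simp
      finally show ?case .
    qed
    moreover have "poly p (-1) = (-1) ^ card W"
    proof -
      have "(-1) ^ card (W - S) = (-1) ^ card W * (-1 :: real) ^ card S" if "S \<in> Pow ?M" for S
      proof -
        have "S \<subseteq> W"
          using that M by auto
        then have "card W = card (W - S) + card S"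
          using psubset.hyps by (metis card_mono card_Diff_subset finite_subset le_add_diff_inverse2)
        then show ?thesis
          by (simp add: power_add flip: power_mult_distrib)
      qed
      \<comment> \<open>The difference equation at \<open>-1\<close>, where its left-hand side is \<open>poly p 0 - poly p (-1)\<close>.\<close>
      then have "- poly p (-1) = (\<Sum>S\<in>Pow ?M - {{}}. (-1) ^ card W * (-1) ^ card S)"
        using p[of "-1"] by (simp add: p0 poly_sum Q1)
      also have "\<dots> = (-1) ^ card W * ((\<Sum>S\<in>Pow ?M. (-1) ^ card S) - 1)"
        using M by (simp add: sum_distrib_left[symmetric] sum_diff1)
      also have "\<dots> = - ((-1) ^ card W)"
        by (simp add: sum_Pow_minus_one_power[OF M(3,1)])
      finally show ?thesis
        by simp
    qed
    ultimately show ?thesis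
      by blast
  qed
qed

text \<open>Along a cycle the labels would increase and return to their initial value.\<close>

lemma strict_labelings_cyclic:
  assumes "D \<subseteq> W \<times> W" "\<not> acyclic D"
  shows "strict_labelings D W t = {}"
proof (rule ccontr)
  assume "strict_labelings D W t \<noteq> {}"
  then obtain c where "c \<in> strict_labelings D W t"
    by blast
  then have c: "c v < c w" if "(v, w) \<in> D" for v w
    using assms(1) that by (auto simp: strict_labelings_def)
  have "c v < c w" if "(v, w) \<in> D\<^sup>+" for v w
    using that by induction (auto dest: c intro: less_trans)
  then show False
    using assms(2) by (auto simp: acyclic_def)
qed

section \<open>Colorings and orientations\<close>

context mixed_graph
begin

lemma orientation_subset:
  assumes "D \<in> orientations E A"
  shows "D \<subseteq> V \<times> V"
proof (rule subrelI)
  fix v w assume "(v, w) \<in> D"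
  then have "(v, w) \<in> A \<or> {v, w} \<in> E"
    using assms by (auto simp: orientations_def) (metis fst_conv snd_conv)
  then show "(v, w) \<in> V \<times> V"
    using edges[of "{v, w}"] arcs[of v w] by blast
qed

lemma finite_orientations: "finite (orientations E A)"
  by (rule finite_subset[of _ "Pow (V \<times> V)"]) (use orientation_subset finite_vertices in auto)

lemma oriented_edge_cases:
  assumes "D \<in> orientations E A" "{v, w} \<in> E"
  shows "(v, w) \<in> D \<or> (w, v) \<in> D"
proof -
  obtain h where h: "\<forall>e\<in>E. {fst (h e), snd (h e)} = e" and D: "D = A \<union> h ` E"
    using assms(1) by (auto simp: orientations_def)
  have "h {v, w} = (v, w) \<or> h {v, w} = (w, v)"
    using h assms(2) by (metis doubleton_eq_iff prod.collapse)
  then show ?thesis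
    using D assms(2) by (metis UnCI image_eqI)
qed

text \<open>
  A strict labeling determines its orientation, since an undirected edge can only point to its
  larger label. This makes the union in \<open>proper_colorings_eq_UN\<close> disjoint.
\<close>

lemma orientation_of_labeling:
  assumes D: "D \<in> orientations E A" and c: "c \<in> strict_labelings D V t"
  shows "D = A \<union> {(v, w). {v, w} \<in> E \<and> c v < c w}"
proof -
  have inc: "c v < c w" if "(v, w) \<in> D" for v w
    using orientation_subset[OF D] c that by (auto simp: strict_labelings_def)
  have "(v, w) \<in> D" if "{v, w} \<in> E" "c v < c w" for v w
    using oriented_edge_cases[OF D that(1)] inc that(2) by fastforce
  moreover have "{v, w} \<in> E" if "(v, w) \<in> D" "(v, w) \<notin> A" for v w
    using D that by (auto simp: orientations_def) (metis fst_conv snd_conv)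
  moreover have "A \<subseteq> D"
    using D by (auto simp: orientations_def)
  ultimately show ?thesis
    using inc by blast
qed

lemma increasing_orientation:
  assumes c: "\<And>v w. {v, w} \<in> E \<Longrightarrow> c v \<noteq> (c w :: nat)"
  shows "A \<union> {(v, w). {v, w} \<in> E \<and> c v < c w} \<in> orientations E A"
proof -
  have "\<exists>x. {fst x, snd x} = e \<and> c (fst x) < c (snd x)" if e_in: "e \<in> E" for e
  proof -
    obtain v w where e: "e = {v, w}"
      using edges[OF e_in] by (auto simp: card_2_iff)
    consider "c v < c w" | "c w < c v"
      using c e_in e by (meson linorder_neqE_nat)
    then show ?thesis
      by cases (use e in \<open>force+\<close>)
  qed
  then obtain h where h: "\<And>e. e \<in> E \<Longrightarrow> {fst (h e), snd (h e)} = e \<and> c (fst (h e)) < c (snd (h e))"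
    by metis
  have "{(v, w). {v, w} \<in> E \<and> c v < c w} = h ` E"
  proof (intro equalityI subsetI)
    fix x assume "x \<in> {(v, w). {v, w} \<in> E \<and> c v < c w}"
    then have E: "{fst x, snd x} \<in> E" and lt: "c (fst x) < c (snd x)"
      by auto
    have "x = h {fst x, snd x}"
      using h[OF E] lt by (metis doubleton_eq_iff less_asym prod.collapse)
    then show "x \<in> h ` E"
      using E by blast
  next
    fix x assume "x \<in> h ` E"
    then show "x \<in> {(v, w). {v, w} \<in> E \<and> c v < c w}"
      using h by (auto simp: case_prod_beta)
  qed
  then show ?thesis
    using h by (auto simp: orientations_def)
qed

lemma proper_colorings_eq_UN:
  "proper_colorings V E A t = (\<Union>D\<in>orientations E A. strict_labelings D V t)"
proof (intro equalityI subsetI)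
  fix c assume c: "c \<in> proper_colorings V E A t"
  then have "A \<union> {(v, w). {v, w} \<in> E \<and> c v < c w} \<in> orientations E A"
    by (intro increasing_orientation) (auto simp: proper_colorings_def)
  moreover have "c \<in> strict_labelings (A \<union> {(v, w). {v, w} \<in> E \<and> c v < c w}) V t"
    using c by (auto simp: proper_colorings_def strict_labelings_def)
  ultimately show "c \<in> (\<Union>D\<in>orientations E A. strict_labelings D V t)"
    by blast
next
  fix c assume "c \<in> (\<Union>D\<in>orientations E A. strict_labelings D V t)"
  then obtain D where D: "D \<in> orientations E A" and c: "c \<in> strict_labelings D V t"
    by blast
  have inc: "c v < c w" if "(v, w) \<in> D" for v w
    using orientation_subset[OF D] c that by (auto simp: strict_labelings_def)
  have "c v \<noteq> c w" if "{v, w} \<in> E" for v w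
    using oriented_edge_cases[OF D that] inc by fastforce
  moreover have "A \<subseteq> D"
    using D by (auto simp: orientations_def)
  ultimately show "c \<in> proper_colorings V E A t"
    using c inc by (auto simp: proper_colorings_def strict_labelings_def)
qed

lemma card_proper_colorings:
  "card (proper_colorings V E A t) = (\<Sum>D\<in>orientations E A. card (strict_labelings D V t))"
  unfolding proper_colorings_eq_UN
proof (rule card_UN_disjoint)
  show "\<forall>D\<in>orientations E A. \<forall>D'\<in>orientations E A. D \<noteq> D' \<longrightarrow>
          strict_labelings D V t \<inter> strict_labelings D' V t = {}"
    using orientation_of_labeling by blast
qed (simp_all add: finite_orientations finite_strict_labelings finite_vertices)

lemma card_proper_colorings_acyclic:
  "card (proper_colorings V E A t) = (\<Sum>D\<in>acyclic_orientations E A. card (strict_labelings D V t))"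
  unfolding card_proper_colorings
  by (rule sum.mono_neutral_right[OF finite_orientations])
     (auto simp: acyclic_orientations_def strict_labelings_cyclic orientation_subset)

end

lemma chromatic_poly_eqI:
  assumes "\<And>t. poly p (real t) = real (card (proper_colorings V E A t))"
  shows "chromatic_poly V E A = p"
  unfolding chromatic_poly_def
  by (rule the_equality) (use assms in \<open>auto intro: poly_eq_if_eq_on_nat\<close>)

theorem corollary3:
  fixes V :: "'a set" and E :: "'a set set" and A :: "('a \<times> 'a) set"
  assumes "mixed_graph V E A"
  shows "(-1) ^ card V * poly (chromatic_poly V E A) (-1) = real (card (acyclic_orientations E A))"
proof -
  interpret mixed_graph V E A
    by (fact assms)
  let ?O = "acyclic_orientations E A"
  have "\<forall>D\<in>?O. \<exists>p :: real poly.
      (\<forall>t. poly p (real t) = real (card (strict_labelings D V t))) \<and> poly p (-1) = (-1) ^ card V"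
    using strict_order_polynomial[OF finite_vertices] by (auto simp: acyclic_orientations_def)
  then obtain P :: "('a \<times> 'a) set \<Rightarrow> real poly" where
    P: "\<And>D t. D \<in> ?O \<Longrightarrow> poly (P D) (real t) = real (card (strict_labelings D V t))"
    and P1: "\<And>D. D \<in> ?O \<Longrightarrow> poly (P D) (-1) = (-1) ^ card V"
    by metis
  have "chromatic_poly V E A = (\<Sum>D\<in>?O. P D)"
    by (rule chromatic_poly_eqI) (simp add: poly_sum P card_proper_colorings_acyclic)
  then have "(-1) ^ card V * poly (chromatic_poly V E A) (-1)
      = (\<Sum>D\<in>?O. (-1) ^ card V * (-1) ^ card V)"
    by (simp add: poly_sum P1)
  also have "\<dots> = real (card ?O)"
    by (simp flip: power_mult_distrib)
  finally show ?thesis .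
qed

end
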